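(* Let $\nu_v,\nu_w,\rho\in\mathbb{R}$ with $\nu_v\neq 0$ and $|\rho|<1$, and for $x\in\mathbb{R}$, $t>0$ let $h(x,t)$ be the density at $x$ of the ratio $\mathbf{w}/\mathbf{v}$, where $(\mathbf{v},\mathbf{w})$ is jointly Gaussian with mean $(\nu_v,\nu_w)$ and covariance matrix $t\begin{pmatrix}1&\rho\\ \rho&1\end{pmatrix}$. Define the polynomials in $x$ $$P_1(x)=2(\nu_w-\nu_v x)^2\,[\nu_v+\nu_w x-(\nu_w+\nu_v x)\rho]\,(\rho^2-1),$$ $$P_2(x)=(1+x^2-2x\rho)\,\bigl[\nu_w(\rho-x)(3x^2-6x\rho+11\rho^2-8)+\nu_v(2-9x^2+10x\rho+3x^3\rho-5\rho^2-x\rho^3)\bigr],$$ $$P_3(x)=(1+x^2-2x\rho)^2\,\bigl\{\nu_w(1-x^2+2x\rho-2\rho^2)+\nu_v[\rho+x(-2+x\rho)]\bigr\},$$ $$Q_1(x)=2(1-\rho^2)(\nu_w-\nu_v x)^2(\nu_w-\nu_v\rho),$$ $$Q_2(x)=2(\rho^2-1)\,\bigl\{\nu_w(1+4x^2-8x\rho+3\rho^2)-\nu_v[\rho+x(3x^2-5x\rho+\rho^2)]\bigr\},$$ and the coefficients $$D(x,t)=\frac{P_3(x)}{Q_1(x)+tQ_2(x)},\qquad S(t)=\frac{\nu_v^2+\nu_w^2-2\nu_v\nu_w\rho+2t(\rho^2-1)}{2t^3(1-\rho^2)^{3/2}}\cdot\sqrt{(1-\rho^2)t^2},$$ $$C(x,t)=\frac{P_1(x)+tP_2(x)}{t\,(Q_1(x)+tQ_2(x))}-\frac{P_3'(x)}{Q_1(x)+tQ_2(x)}+\frac{P_3(x)\,(Q_1'(x)+tQ_2'(x))}{(Q_1(x)+tQ_2(x))^2},$$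 where primes denote derivatives with respect to $x$. Then $h$ solves the partial differential equation $$\frac{\partial h}{\partial t}(x,t)=\frac{\partial}{\partial x}\Bigl[D(x,t)\frac{\partial h}{\partial x}(x,t)\Bigr]+C(x,t)\frac{\partial h}{\partial x}(x,t)+S(t)\,h(x,t)$$ at all $(x,t)$ with $t>0$ at which the coefficients are defined, i.e. $Q_1(x)+tQ_2(x)\neq 0$. Moreover, $Q_1(x)+tQ_2(x)$ is a cubic polynomial in $x$ with one, two or three real zeros depending on the values of $t,\nu_v,\nu_w,\rho$.
   Context: The density $h$ is given explicitly by $$h(x,t)=\frac{e^{-c(t)}}{2\pi\, d(t)^{1/2}\,a(x,t)}\;{}_1F_1\!\left[1,\tfrac12,\frac{b(x,t)^2}{a(x,t)}\right],$$ where ${}_1F_1$ is the confluent hypergeometric function of the first kind and $$a(x,t)=\frac{1-2\rho x+x^2}{2(1-\rho^2)t},\quad b(x,t)=\frac{\nu_v-\rho\nu_w+(\nu_w-\rho\nu_v)x}{2(1-\rho^2)t},\quad c(t)=\frac{\nu_v^2-2\rho\nu_w\nu_v+\nu_w^2}{2(1-\rho^2)t},\quad d(t)=(1-\rho^2)t^2 .$$ Equivalently, $h(x,t)=\frac{1}{2\pi d(t)^{1/2}}\int_{-\infty}^{\infty}|\lambda|e^{-a(x,t)\lambda^2+2b(x,t)\lambda-c(t)}\,d\lambda$. *)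

theory Defs
  imports "HOL-Probability.Probability"
begin

definition hyp1F1 :: "real \<Rightarrow> real \<Rightarrow> real \<Rightarrow> real" where
  "hyp1F1 p q z = eval_fps (fps_hypergeo [p] [q] 1) z"

(* Density with respect to Lebesgue measure on the plane; Sigma is the covariance matrix. *)
definition bivariate_normal_density :: "real^2 \<Rightarrow> real^2^2 \<Rightarrow> real \<times> real \<Rightarrow> real" where
  "bivariate_normal_density \<mu> \<Sigma> = (\<lambda>(v, w).
     exp (- ((vector [v, w] - \<mu>) \<bullet> (matrix_inv \<Sigma> *v (vector [v, w] - \<mu>))) / 2)
       / (2 * pi * sqrt (det \<Sigma>)))"

definition jointly_gaussian2 ::
  "'a measure \<Rightarrow> ('a \<Rightarrow> real) \<Rightarrow> ('a \<Rightarrow> real) \<Rightarrow> real^2 \<Rightarrow> real^2^2 \<Rightarrow> bool" where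
  "jointly_gaussian2 M V W \<mu> \<Sigma> \<longleftrightarrow>
     prob_space M \<and>
     distributed M lborel (\<lambda>\<omega>. (V \<omega>, W \<omega>)) (\<lambda>z. ennreal (bivariate_normal_density \<mu> \<Sigma> z))"

definition h_a :: "real \<Rightarrow> real \<Rightarrow> real \<Rightarrow> real" where
  "h_a \<rho> x t = (1 - 2*\<rho>*x + x^2) / (2 * (1 - \<rho>^2) * t)"

definition h_b :: "real \<Rightarrow> real \<Rightarrow> real \<Rightarrow> real \<Rightarrow> real \<Rightarrow> real" where
  "h_b \<nu>v \<nu>w \<rho> x t = (\<nu>v - \<rho>*\<nu>w + (\<nu>w - \<rho>*\<nu>v)*x) / (2 * (1 - \<rho>^2) * t)"

definition h_c :: "real \<Rightarrow> real \<Rightarrow> real \<Rightarrow> real \<Rightarrow> real" where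
  "h_c \<nu>v \<nu>w \<rho> t = (\<nu>v^2 - 2*\<rho>*\<nu>w*\<nu>v + \<nu>w^2) / (2 * (1 - \<rho>^2) * t)"

definition h_d :: "real \<Rightarrow> real \<Rightarrow> real" where
  "h_d \<rho> t = (1 - \<rho>^2) * t^2"

(* The version of the density of W / V that is smooth in x; the theorem includes that it is one. *)
definition ratio_density :: "real \<Rightarrow> real \<Rightarrow> real \<Rightarrow> real \<Rightarrow> real \<Rightarrow> real" where
  "ratio_density \<nu>v \<nu>w \<rho> x t =
     exp (- h_c \<nu>v \<nu>w \<rho> t) / (2 * pi * sqrt (h_d \<rho> t) * h_a \<rho> x t)
       * hyp1F1 1 (1/2) ((h_b \<nu>v \<nu>w \<rho> x t)^2 / h_a \<rho> x t)"

definition P1 :: "real \<Rightarrow> real \<Rightarrow> real \<Rightarrow> real \<Rightarrow> real" where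
  "P1 \<nu>v \<nu>w \<rho> x = 2 * (\<nu>w - \<nu>v*x)^2 * (\<nu>v + \<nu>w*x - (\<nu>w + \<nu>v*x)*\<rho>) * (\<rho>^2 - 1)"

definition P2 :: "real \<Rightarrow> real \<Rightarrow> real \<Rightarrow> real \<Rightarrow> real" where
  "P2 \<nu>v \<nu>w \<rho> x = (1 + x^2 - 2*x*\<rho>) *
     (\<nu>w * (\<rho> - x) * (3*x^2 - 6*x*\<rho> + 11*\<rho>^2 - 8)
      + \<nu>v * (2 - 9*x^2 + 10*x*\<rho> + 3*x^3*\<rho> - 5*\<rho>^2 - x*\<rho>^3))"

definition P3 :: "real \<Rightarrow> real \<Rightarrow> real \<Rightarrow> real \<Rightarrow> real" where
  "P3 \<nu>v \<nu>w \<rho> x = (1 + x^2 - 2*x*\<rho>)^2 *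
     (\<nu>w * (1 - x^2 + 2*x*\<rho> - 2*\<rho>^2) + \<nu>v * (\<rho> + x*(-2 + x*\<rho>)))"

definition Q1 :: "real \<Rightarrow> real \<Rightarrow> real \<Rightarrow> real \<Rightarrow> real" where
  "Q1 \<nu>v \<nu>w \<rho> x = 2 * (1 - \<rho>^2) * (\<nu>w - \<nu>v*x)^2 * (\<nu>w - \<nu>v*\<rho>)"

definition Q2 :: "real \<Rightarrow> real \<Rightarrow> real \<Rightarrow> real \<Rightarrow> real" where
  "Q2 \<nu>v \<nu>w \<rho> x = 2 * (\<rho>^2 - 1) *
     (\<nu>w * (1 + 4*x^2 - 8*x*\<rho> + 3*\<rho>^2) - \<nu>v * (\<rho> + x*(3*x^2 - 5*x*\<rho> + \<rho>^2)))"

definition coeff_D :: "real \<Rightarrow> real \<Rightarrow> real \<Rightarrow> real \<Rightarrow> real \<Rightarrow> real" where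
  "coeff_D \<nu>v \<nu>w \<rho> x t = P3 \<nu>v \<nu>w \<rho> x / (Q1 \<nu>v \<nu>w \<rho> x + t * Q2 \<nu>v \<nu>w \<rho> x)"

definition coeff_S :: "real \<Rightarrow> real \<Rightarrow> real \<Rightarrow> real \<Rightarrow> real" where
  "coeff_S \<nu>v \<nu>w \<rho> t =
     (\<nu>v^2 + \<nu>w^2 - 2*\<nu>v*\<nu>w*\<rho> + 2*t*(\<rho>^2 - 1)) / (2 * t^3 * (1 - \<rho>^2) powr (3/2))
       * sqrt ((1 - \<rho>^2) * t^2)"

definition coeff_C :: "real \<Rightarrow> real \<Rightarrow> real \<Rightarrow> real \<Rightarrow> real \<Rightarrow> real" where
  "coeff_C \<nu>v \<nu>w \<rho> x t =
     (P1 \<nu>v \<nu>w \<rho> x + t * P2 \<nu>v \<nu>w \<rho> x) / (t * (Q1 \<nu>v \<nu>w \<rho> x + t * Q2 \<nu>v \<nu>w \<rho> x))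
     - deriv (P3 \<nu>v \<nu>w \<rho>) x / (Q1 \<nu>v \<nu>w \<rho> x + t * Q2 \<nu>v \<nu>w \<rho> x)
     + P3 \<nu>v \<nu>w \<rho> x * (deriv (Q1 \<nu>v \<nu>w \<rho>) x + t * deriv (Q2 \<nu>v \<nu>w \<rho>) x)
         / (Q1 \<nu>v \<nu>w \<rho> x + t * Q2 \<nu>v \<nu>w \<rho> x)^2"

definition Q_zeros :: "real \<Rightarrow> real \<Rightarrow> real \<Rightarrow> real \<Rightarrow> real set" where
  "Q_zeros \<nu>v \<nu>w \<rho> t = {x. Q1 \<nu>v \<nu>w \<rho> x + t * Q2 \<nu>v \<nu>w \<rho> x = 0}"

end

theory Submission
  imports Defs "HOL-Real_Asymp.Real_Asymp"
begin

text \<open>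
  The substitution \<open>w = x v\<close> gives the density of a quotient as the integral of \<open>\<bar>v\<bar> f(v, x v)\<close> over
  \<open>v\<close> (\<open>distributed_ratio\<close>). For a Gaussian pair the integrand is \<open>\<bar>v\<bar>\<close> times the exponential of the
  quadratic polynomial \<open>- a v\<^sup>2 + 2 b v - c\<close>, and expanding \<open>cosh (2 b v)\<close> integrates it to the
  confluent hypergeometric function at \<open>b\<^sup>2 / a\<close> (\<open>nn_integral_abs_gaussian\<close>).

  For the differential equation, write \<open>h = k u\<close>, where the amplitude \<open>k\<close> depends on \<open>t\<close> only and
  \<open>u = F(\<zeta>) / A\<close> with \<open>F\<close> the hypergeometric function, \<open>\<zeta> = b\<^sup>2 / a\<close> and
  \<open>A = 1 - 2 \<rho> x + x\<^sup>2\<close>. Since \<open>S\<close> is the logarithmic derivative of \<open>k\<close> minus \<open>1 / t\<close>, and \<open>\<zeta>\<close> is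
  inversely proportional to \<open>t\<close>, the left side minus \<open>S h\<close> equals \<open>k (F - \<zeta> F') / (t A)\<close>. On the
  right, the last two terms of \<open>C\<close> are \<open>- \<partial>D/\<partial>x\<close>, so that the equation reads
  \<open>(F - \<zeta> F') / (t A) = D u\<^sub>x\<^sub>x + (P\<^sub>1 + t P\<^sub>2) / (t Q) u\<^sub>x\<close> with \<open>Q = Q\<^sub>1 + t Q\<^sub>2\<close>. Kummer's equation
  \<open>\<zeta> F'' = F + (\<zeta> - 1/2) F'\<close> (\<open>kummer_ode\<close>) makes both sides linear in \<open>F\<close> and \<open>F'\<close>. Comparing the
  coefficients of \<open>F\<close> and \<open>F'\<close> gives two linear equations for the two coefficients on the right, with
  determinant \<open>Q\<close> up to the numerator of \<open>b\<close> and factors without zeros. The given coefficients are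
  the solution (\<open>profile_pde\<close>).

  The polynomial \<open>Q\<close> has leading coefficient \<open>6 t (1 - \<rho>\<^sup>2) \<nu>v \<noteq> 0\<close>, so it is a cubic with one to three
  real zeros, and explicit parameters realise each of the three numbers.
\<close>

section \<open>Kummer's differential equation\<close>

lemma fps_conv_radius_kummer:
  fixes p q :: real
  assumes "p > 0" "q > 0"
  shows "fps_conv_radius (fps_hypergeo [p] [q] 1) = \<infinity>"
proof -
  let ?f = "fps_hypergeo [p] [q] (1::real)"
  have nz: "fps_nth ?f n \<noteq> 0" for n
    using assms pochhammer_pos[of p n] pochhammer_pos[of q n] by auto
  have "norm (fps_nth ?f n) / norm (fps_nth ?f (Suc n)) = (real n + 1) * (q + real n) / (p + real n)" for n
  proof -
    have "fps_nth ?f (Suc n) = (p + real n) / ((real n + 1) * (q + real n)) * fps_nth ?f n"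
      by (subst fps_hypergeo_rec) (simp add: field_simps)
    then show ?thesis
      using nz[of n] assms by (simp add: abs_mult abs_of_pos add_pos_nonneg del: fps_hypergeo_nth)
  qed
  moreover have "filterlim (\<lambda>n. (real n + 1) * (q + real n) / (p + real n)) at_top sequentially"
    by real_asymp
  ultimately have "(\<lambda>n. ereal (norm (fps_nth ?f n) / norm (fps_nth ?f (Suc n)))) \<longlonglongrightarrow> \<infinity>"
    by (simp add: tendsto_PInfty_eq_at_top)
  then show ?thesis
    unfolding fps_conv_radius_def by (intro conv_radius_ratio_limit_ereal_nonzero) (simp_all del: fps_hypergeo_nth)
qed

text \<open>The equation is equivalent to the two-term recurrence
  \<open>(n + 1) (q + n) f\<^sub>n\<^sub>+\<^sub>1 = (p + n) f\<^sub>n\<close> of the hypergeometric coefficients.\<close>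

lemma kummer_ode_fps:
  fixes p q :: real
  assumes "q > 0"
  defines "f \<equiv> fps_hypergeo [p] [q] 1"
  shows "fps_X * fps_deriv (fps_deriv f) + (fps_const q - fps_X) * fps_deriv f = fps_const p * f"
proof (rule fps_ext)
  fix n
  have rec: "fps_nth f (Suc n) = (p + n) / ((n + 1) * (q + n)) * fps_nth f n" for n
    unfolding f_def by (subst fps_hypergeo_rec) (simp add: field_simps)
  show "fps_nth (fps_X * fps_deriv (fps_deriv f) + (fps_const q - fps_X) * fps_deriv f) n
      = fps_nth (fps_const p * f) n"
  proof (cases n)
    case 0
    then show ?thesis
      using rec[of 0] assms(1) by (simp add: algebra_simps fps_mult_nth_0)
  next
    case (Suc m)
    have "q + (real m + 1) \<noteq> 0" using assms(1) by linarith
    then have "(real m + 2) * (q + (real m + 1)) * fps_nth f (Suc (Suc m)) = (p + (real m + 1)) * fps_nth f (Suc m)"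
      unfolding rec[of "Suc m"] by (simp add: add.commute)
    then show ?thesis
      by (simp add: Suc ring_distribs algebra_simps)
  qed
qed

definition hyp1F1_d1 :: "real \<Rightarrow> real \<Rightarrow> real \<Rightarrow> real" where
  "hyp1F1_d1 p q = eval_fps (fps_deriv (fps_hypergeo [p] [q] (1::real)))"

definition hyp1F1_d2 :: "real \<Rightarrow> real \<Rightarrow> real \<Rightarrow> real" where
  "hyp1F1_d2 p q = eval_fps (fps_deriv (fps_deriv (fps_hypergeo [p] [q] (1::real))))"

text \<open>The series converges everywhere, so Kummer's equation passes from the power series to the
  functions that it represents.\<close>

lemma
  fixes p q :: real
  assumes "p > 0" "q > 0"
  shows hyp1F1_deriv: "(hyp1F1 p q has_real_derivative hyp1F1_d1 p q z) (at z)"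
    and hyp1F1_deriv2: "(hyp1F1_d1 p q has_real_derivative hyp1F1_d2 p q z) (at z)"
    and kummer_ode: "z * hyp1F1_d2 p q z = p * hyp1F1 p q z + (z - q) * hyp1F1_d1 p q z"
proof -
  define f where "f = fps_hypergeo [p] [q] (1::real)"
  have r0: "fps_conv_radius f = \<infinity>"
    using fps_conv_radius_kummer[OF assms] by (simp add: f_def)
  have r1: "fps_conv_radius (fps_deriv f) = \<infinity>"
    using fps_conv_radius_deriv[of f] r0 by simp
  have r2: "fps_conv_radius (fps_deriv (fps_deriv f)) = \<infinity>"
    using fps_conv_radius_deriv[of "fps_deriv f"] r1 by simp
  show "(hyp1F1 p q has_real_derivative hyp1F1_d1 p q z) (at z)"
    unfolding hyp1F1_def[abs_def] hyp1F1_d1_def f_def[symmetric]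
    by (rule has_field_derivative_eval_fps) (simp add: r0)
  show "(hyp1F1_d1 p q has_real_derivative hyp1F1_d2 p q z) (at z)"
    unfolding hyp1F1_d1_def hyp1F1_d2_def f_def[symmetric]
    by (rule has_field_derivative_eval_fps) (simp add: r1)
  have d: "fps_conv_radius (fps_const q - fps_X) = \<infinity>"
    using fps_conv_radius_diff[of "fps_const q" fps_X] by simp
  have m1: "fps_conv_radius (fps_X * fps_deriv (fps_deriv f)) = \<infinity>"
    using fps_conv_radius_mult[of fps_X "fps_deriv (fps_deriv f)"] r2 by simp
  have m2: "fps_conv_radius ((fps_const q - fps_X) * fps_deriv f) = \<infinity>"
    using fps_conv_radius_mult[of "fps_const q - fps_X" "fps_deriv f"] r1 d by simp
  have "eval_fps (fps_X * fps_deriv (fps_deriv f) + (fps_const q - fps_X) * fps_deriv f) z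
      = eval_fps (fps_const p * f) z"
    using kummer_ode_fps[OF assms(2)] unfolding f_def by simp
  then have "z * hyp1F1_d2 p q z + (q - z) * hyp1F1_d1 p q z = p * hyp1F1 p q z"
    by (simp add: eval_fps_add eval_fps_mult eval_fps_diff r0 r1 r2 d m1 m2
        hyp1F1_d1_def hyp1F1_d2_def hyp1F1_def f_def[symmetric])
  then show "z * hyp1F1_d2 p q z = p * hyp1F1 p q z + (z - q) * hyp1F1_d1 p q z"
    by (simp add: algebra_simps)
qed

section \<open>An absolute Gaussian moment\<close>

lemma hyp1F1_one_half_sums:
  "(\<lambda>n. z ^ n / pochhammer (1/2) n) sums hyp1F1 1 (1/2) z"
proof -
  have "summable (\<lambda>n. fps_nth (fps_hypergeo [1] [1/2] (1::real)) n * z ^ n)"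
    by (rule summable_fps) (simp add: fps_conv_radius_kummer)
  then show ?thesis
    by (simp add: hyp1F1_def eval_fps_def pochhammer_fact[symmetric] sums_iff)
qed

lemma cosh_sums_even:
  "(\<lambda>n. x ^ (2 * n) / fact (2 * n)) sums cosh (x::real)"
proof -
  have "strict_mono (\<lambda>n::nat. 2 * n)" by (simp add: strict_mono_def)
  moreover have "(if even n then x ^ n /\<^sub>R fact n else 0) = 0" if "n \<notin> range (\<lambda>n. 2 * n)" for n
    using that by (auto elim!: evenE)
  ultimately have "(\<lambda>n. if even (2 * n) then x ^ (2 * n) /\<^sub>R fact (2 * n) else 0) sums cosh x"
    using cosh_converges[of x] sums_mono_reindex[of "\<lambda>n. 2 * n" "\<lambda>n. if even n then x ^ n /\<^sub>R fact n else 0"]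
    by blast
  then show ?thesis
    by (simp add: field_simps)
qed

lemma nn_integral_gaussian_abs_odd_moment:
  fixes a :: real
  assumes "a > 0"
  shows "(\<integral>\<^sup>+x. ennreal (exp (- a * x^2) * \<bar>x\<bar> ^ (2 * k + 1)) \<partial>lborel) = ennreal (fact k / a ^ (k + 1))"
proof -
  \<comment> \<open>The weight is a multiple of the centred normal density with this standard deviation.\<close>
  define \<sigma> where "\<sigma> = 1 / sqrt (2 * a)"
  have \<sigma>: "\<sigma> > 0" "\<sigma>^2 = 1 / (2 * a)"
    using assms by (auto simp: \<sigma>_def power_divide)
  have "has_bochner_integral lborel (\<lambda>x. normal_density 0 \<sigma> x * \<bar>x\<bar> ^ (2 * k + 1))
      (2 ^ k * \<sigma> ^ (2 * k + 1) * fact k * sqrt (2 / pi))"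
    using normal_moment_abs_odd[OF \<sigma>(1), of 0 k] by simp
  then have "has_bochner_integral lborel (\<lambda>x. sqrt (pi / a) * (normal_density 0 \<sigma> x * \<bar>x\<bar> ^ (2 * k + 1)))
      (sqrt (pi / a) * (2 ^ k * \<sigma> ^ (2 * k + 1) * fact k * sqrt (2 / pi)))"
    by (rule has_bochner_integral_mult_right)
  also have "(\<lambda>x. sqrt (pi / a) * (normal_density 0 \<sigma> x * \<bar>x\<bar> ^ (2 * k + 1)))
     = (\<lambda>x. exp (- a * x^2) * \<bar>x\<bar> ^ (2 * k + 1))"
    using assms by (auto simp: normal_density_def \<sigma>(2) real_sqrt_divide fun_eq_iff)
  also have "sqrt (pi / a) * (2 ^ k * \<sigma> ^ (2 * k + 1) * fact k * sqrt (2 / pi))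
     = fact k * (2 * \<sigma>^2) ^ k * (sqrt (pi / a) * \<sigma> * sqrt (2 / pi))"
    by (simp add: power_mult power_mult_distrib)
  also have "sqrt (pi / a) * \<sigma> * sqrt (2 / pi) = 1 / a"
    using assms by (simp add: \<sigma>_def real_sqrt_divide real_sqrt_mult)
  also have "fact k * (2 * \<sigma>^2) ^ k * (1 / a) = fact k / a ^ (k + 1)"
    using assms by (simp add: \<sigma>(2) power_divide)
  finally have "has_bochner_integral lborel (\<lambda>x. exp (- a * x^2) * \<bar>x\<bar> ^ (2 * k + 1)) (fact k / a ^ (k + 1))" .
  then show ?thesis
    by (subst nn_integral_eq_integral) (auto simp: has_bochner_integral_iff)
qed

text \<open>Adding the integrand to its reflection replaces the exponential of \<open>2 b x\<close> by a hyperbolic cosine.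
  Its series is integrated term by term, which is legitimate because all terms are nonnegative, and
  the moments turn it into the hypergeometric series by
  \<open>4\<^sup>n n! / (2 n)! = 1 / pochhammer (1/2) n\<close>.\<close>

lemma nn_integral_abs_gaussian:
  fixes a b :: real
  assumes "a > 0"
  shows "(\<integral>\<^sup>+x. ennreal (\<bar>x\<bar> * exp (- a * x^2 + 2 * b * x)) \<partial>lborel)
       = ennreal (hyp1F1 1 (1/2) (b^2 / a) / a)"
proof -
  let ?g = "\<lambda>x. \<bar>x\<bar> * exp (- a * x^2 + 2 * b * x)"
  let ?t = "\<lambda>n x. (2 * b) ^ (2 * n) / fact (2 * n) * (exp (- a * x^2) * \<bar>x\<bar> ^ (2 * n + 1))"
  have [measurable]: "(\<lambda>x. cosh (2 * b * x)) \<in> borel_measurable borel"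
    by (intro borel_measurable_continuous_onI continuous_intros)
  have flip: "(\<integral>\<^sup>+x. ennreal (?g x) \<partial>lborel) = (\<integral>\<^sup>+x. ennreal (?g (- x)) \<partial>lborel)"
    by (subst nn_integral_real_affine[where c = "-1" and t = 0]) auto
  have sym: "?g x + ?g (- x) = 2 * (\<bar>x\<bar> * exp (- a * x^2) * cosh (2 * b * x))" for x
    by (simp add: cosh_def exp_diff exp_add exp_minus field_simps)
  have "2 * (\<integral>\<^sup>+x. ennreal (?g x) \<partial>lborel) = (\<integral>\<^sup>+x. ennreal (?g x) \<partial>lborel) + (\<integral>\<^sup>+x. ennreal (?g (- x)) \<partial>lborel)"
    by (subst mult_2) (rule arg_cong2[where f = "(+)", OF refl flip])
  also have "\<dots> = (\<integral>\<^sup>+x. ennreal (?g x + ?g (- x)) \<partial>lborel)"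
    by (subst nn_integral_add[symmetric]) (auto simp: ennreal_plus)
  also have "\<dots> = (\<integral>\<^sup>+x. 2 * ennreal (\<bar>x\<bar> * exp (- a * x^2) * cosh (2 * b * x)) \<partial>lborel)"
    unfolding sym by (simp add: ennreal_mult)
  also have "\<dots> = 2 * (\<integral>\<^sup>+x. ennreal (\<bar>x\<bar> * exp (- a * x^2) * cosh (2 * b * x)) \<partial>lborel)"
    by (rule nn_integral_cmult) measurable
  finally have "(\<integral>\<^sup>+x. ennreal (?g x) \<partial>lborel) = (\<integral>\<^sup>+x. ennreal (\<bar>x\<bar> * exp (- a * x^2) * cosh (2 * b * x)) \<partial>lborel)"
    by (simp add: ennreal_mult_cancel_left)
  also have "\<dots> = (\<integral>\<^sup>+x. (\<Sum>n. ennreal (?t n x)) \<partial>lborel)"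
  proof (rule nn_integral_cong)
    fix x :: real
    have "(\<lambda>n. \<bar>x\<bar> * exp (- a * x^2) * ((2 * b * x) ^ (2 * n) / fact (2 * n)))
       sums (\<bar>x\<bar> * exp (- a * x^2) * cosh (2 * b * x))"
      by (rule sums_mult[OF cosh_sums_even])
    also have "(\<lambda>n. \<bar>x\<bar> * exp (- a * x^2) * ((2 * b * x) ^ (2 * n) / fact (2 * n))) = (\<lambda>n. ?t n x)"
      by (auto simp: fun_eq_iff power_mult_distrib power_mult)
    finally show "ennreal (\<bar>x\<bar> * exp (- a * x^2) * cosh (2 * b * x)) = (\<Sum>n. ennreal (?t n x))"
      by (subst suminf_ennreal2) (auto simp: sums_iff)
  qed
  also have "\<dots> = (\<Sum>n. \<integral>\<^sup>+x. ennreal (?t n x) \<partial>lborel)"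
    by (rule nn_integral_suminf) measurable
  also have "\<dots> = (\<Sum>n. ennreal ((b^2 / a) ^ n / pochhammer (1/2) n / a))"
  proof (rule suminf_cong)
    fix n
    have "(\<integral>\<^sup>+x. ennreal (?t n x) \<partial>lborel)
      = ennreal ((2 * b) ^ (2 * n) / fact (2 * n)) * (\<integral>\<^sup>+x. ennreal (exp (- a * x^2) * \<bar>x\<bar> ^ (2 * n + 1)) \<partial>lborel)"
      by (subst nn_integral_cmult[symmetric]) (simp_all add: ennreal_mult'[symmetric])
    also have "\<dots> = ennreal ((2 * b) ^ (2 * n) / fact (2 * n) * (fact n / a ^ (n + 1)))"
      using assms by (subst nn_integral_gaussian_abs_odd_moment) (simp_all add: ennreal_mult'[symmetric])
    also have "(2 * b) ^ (2 * n) / fact (2 * n) * (fact n / a ^ (n + 1)) = (b^2 / a) ^ n / pochhammer (1/2) n / a"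
      using assms by (simp add: fact_double power_mult_distrib power_mult power_divide)
    finally show "(\<integral>\<^sup>+x. ennreal (?t n x) \<partial>lborel) = ennreal ((b^2 / a) ^ n / pochhammer (1/2) n / a)" .
  qed
  also have "\<dots> = ennreal (hyp1F1 1 (1/2) (b^2 / a) / a)"
    using sums_divide[OF hyp1F1_one_half_sums[of "b^2/a"], of a] assms
    by (subst suminf_ennreal2) (auto simp: sums_iff pochhammer_nonneg intro!: divide_nonneg_nonneg)
  finally show ?thesis .
qed

section \<open>The density of a quotient\<close>

text \<open>For fixed \<open>v \<noteq> 0\<close> the substitution \<open>w = x v\<close> turns \<open>dw\<close> into \<open>\<bar>v\<bar> dx\<close>; the line
  \<open>v = 0\<close>, on which the quotient takes its default value, is a null set.\<close>

lemma distributed_ratio: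
  fixes V W :: "'a \<Rightarrow> real" and f :: "real \<times> real \<Rightarrow> ennreal"
  assumes VW: "distributed M lborel (\<lambda>\<omega>. (V \<omega>, W \<omega>)) f"
  shows "distributed M lborel (\<lambda>\<omega>. W \<omega> / V \<omega>) (\<lambda>x. \<integral>\<^sup>+v. ennreal \<bar>v\<bar> * f (v, x * v) \<partial>lborel)"
proof -
  have f[measurable]: "f \<in> borel_measurable (borel \<Otimes>\<^sub>M borel)"
    using distributed_borel_measurable[OF VW] by (simp add: borel_prod)
  have "(\<lambda>\<omega>. (V \<omega>, W \<omega>)) \<in> M \<rightarrow>\<^sub>M borel \<Otimes>\<^sub>M borel"
    using distributed_measurable[OF VW] by (simp add: borel_prod)
  then have [measurable]: "V \<in> borel_measurable M" "W \<in> borel_measurable M"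
    by (simp_all add: measurable_pair_iff comp_def)
  let ?g = "\<lambda>x. \<integral>\<^sup>+v. ennreal \<bar>v\<bar> * f (v, x * v) \<partial>lborel"
  have g[measurable]: "?g \<in> borel_measurable borel"
    by measurable
  have "distr M lborel (\<lambda>\<omega>. W \<omega> / V \<omega>) = density lborel ?g"
  proof (rule measure_eqI)
    fix A assume "A \<in> sets (distr M lborel (\<lambda>\<omega>. W \<omega> / V \<omega>))"
    then have A[measurable]: "A \<in> sets borel" by simp
    let ?I = "indicator A :: real \<Rightarrow> ennreal"
    have "emeasure (distr M lborel (\<lambda>\<omega>. W \<omega> / V \<omega>)) A = (\<integral>\<^sup>+y. ?I y \<partial>distr M lborel (\<lambda>\<omega>. W \<omega> / V \<omega>))"
      by simp
    also have "\<dots> = (\<integral>\<^sup>+\<omega>. ?I (W \<omega> / V \<omega>) \<partial>M)"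
      by (rule nn_integral_distr) auto
    also have "\<dots> = (\<integral>\<^sup>+z. f z * ?I (snd z / fst z) \<partial>lborel)"
      using distributed_nn_integral[OF VW, of "\<lambda>z. ?I (snd z / fst z)"]
      by (simp add: borel_prod[symmetric])
    also have "\<dots> = (\<integral>\<^sup>+v. \<integral>\<^sup>+w. f (v, w) * ?I (w / v) \<partial>lborel \<partial>lborel)"
      by (subst lborel_prod[symmetric], subst lborel.nn_integral_fst[symmetric]) auto
    also have "\<dots> = (\<integral>\<^sup>+v. \<integral>\<^sup>+x. ennreal \<bar>v\<bar> * f (v, x * v) * ?I x \<partial>lborel \<partial>lborel)"
    proof (rule nn_integral_cong_AE)
      show "AE v in lborel. (\<integral>\<^sup>+w. f (v, w) * ?I (w / v) \<partial>lborel)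
          = (\<integral>\<^sup>+x. ennreal \<bar>v\<bar> * f (v, x * v) * ?I x \<partial>lborel)"
        using AE_lborel_singleton[of "0::real"]
      proof eventually_elim
        case (elim v)
        have "(\<integral>\<^sup>+w. f (v, w) * ?I (w / v) \<partial>lborel)
            = ennreal \<bar>v\<bar> * (\<integral>\<^sup>+x. f (v, 0 + v * x) * ?I ((0 + v * x) / v) \<partial>lborel)"
          by (rule nn_integral_real_affine) (use elim in auto)
        also have "\<dots> = (\<integral>\<^sup>+x. ennreal \<bar>v\<bar> * (f (v, x * v) * ?I x) \<partial>lborel)"
          using elim by (subst nn_integral_cmult[symmetric]) (auto simp: mult.commute)
        finally show ?case by (simp add: mult.assoc)
      qed
    qed
    also have "\<dots> = (\<integral>\<^sup>+x. \<integral>\<^sup>+v. ennreal \<bar>v\<bar> * f (v, x * v) * ?I x \<partial>lborel \<partial>lborel)"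
      by (rule lborel_pair.Fubini') measurable
    also have "\<dots> = (\<integral>\<^sup>+x. ?g x * ?I x \<partial>lborel)"
      by (intro nn_integral_cong nn_integral_multc) measurable
    also have "\<dots> = emeasure (density lborel ?g) A"
      by (subst emeasure_density) auto
    finally show "emeasure (distr M lborel (\<lambda>\<omega>. W \<omega> / V \<omega>)) A = emeasure (density lborel ?g) A" .
  qed simp
  then show ?thesis
    unfolding distributed_def by simp
qed

section \<open>The quotient of a correlated Gaussian pair\<close>

lemma matrix_inv_eqI:
  fixes A B :: "real^'n^'n"
  assumes "A ** B = mat 1" "B ** A = mat 1"
  shows "matrix_inv A = B"
proof -
  have "A ** matrix_inv A = mat 1"
    unfolding matrix_inv_def by (rule someI2[of _ B]) (use assms in auto)
  then have "B ** (A ** matrix_inv A) = B" by simp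
  then show ?thesis by (simp add: matrix_mul_assoc assms)
qed

lemma bivariate_normal_density_equicorrelated:
  fixes t \<rho> \<mu>v \<mu>w v w :: real
  assumes t: "t > 0" and \<rho>: "\<bar>\<rho>\<bar> < 1"
  shows "bivariate_normal_density (vector [\<mu>v, \<mu>w]) (t *\<^sub>R vector [vector [1, \<rho>], vector [\<rho>, 1]]) (v, w)
    = exp (- ((v - \<mu>v)^2 - 2 * \<rho> * (v - \<mu>v) * (w - \<mu>w) + (w - \<mu>w)^2) / (2 * (1 - \<rho>^2) * t))
       / (2 * pi * sqrt ((1 - \<rho>^2) * t^2))"
proof -
  let ?S = "t *\<^sub>R (vector [vector [1, \<rho>], vector [\<rho>, 1]] :: real^2^2)"
  let ?T = "(1 / ((1 - \<rho>^2) * t)) *\<^sub>R (vector [vector [1, - \<rho>], vector [- \<rho>, 1]] :: real^2^2)"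
  have r: "1 - \<rho>^2 > 0" using \<rho> by (simp add: abs_square_less_1)
  have "?S ** ?T = mat 1" "?T ** ?S = mat 1"
    using t r by (simp_all add: vec_eq_iff matrix_matrix_mult_def sum_2 forall_2 mat_def divide_simps)
      (simp_all add: algebra_simps power2_eq_square)
  then have inv: "matrix_inv ?S = ?T" by (rule matrix_inv_eqI)
  have det: "det ?S = (1 - \<rho>^2) * t^2"
    by (simp add: det_2 algebra_simps power2_eq_square)
  let ?q = "(v - \<mu>v)^2 - 2 * \<rho> * (v - \<mu>v) * (w - \<mu>w) + (w - \<mu>w)^2"
  have "(vector [v, w] - vector [\<mu>v, \<mu>w]) \<bullet> (?T *v (vector [v, w] - vector [\<mu>v, \<mu>w])) = ?q / s"
    if "s = (1 - \<rho>^2) * t" "s \<noteq> 0" for s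
    unfolding that(1)[symmetric] using that(2)
    by (simp add: inner_vec_def matrix_vector_mult_def sum_2 divide_simps)
       (simp add: algebra_simps power2_eq_square)
  from this[OF refl] have "(vector [v, w] - vector [\<mu>v, \<mu>w]) \<bullet> (?T *v (vector [v, w] - vector [\<mu>v, \<mu>w]))
      = ?q / ((1 - \<rho>^2) * t)"
    using r t by simp
  moreover have "- (q / (a * b)) / 2 = - q / (2 * a * b)" for q a b :: real
    by (simp add: mult_ac)
  ultimately show ?thesis
    by (simp only: bivariate_normal_density_def inv det prod.case)
qed

lemma one_minus_square_pos: "\<bar>\<rho>\<bar> < 1 \<Longrightarrow> 0 < 1 - (\<rho>::real)^2"
  by (simp add: abs_square_less_1)

lemma quadratic_form_pos:
  fixes \<rho> x :: real
  assumes "\<bar>\<rho>\<bar> < 1"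
  shows "0 < 1 - 2*\<rho>*x + x^2"
proof -
  have "1 - 2*\<rho>*x + x^2 = (x - \<rho>)^2 + (1 - \<rho>^2)"
    by (simp add: power2_eq_square algebra_simps)
  then show ?thesis
    using one_minus_square_pos[OF assms] zero_le_power2[of "x - \<rho>"] by linarith
qed

lemma h_a_pos: "\<bar>\<rho>\<bar> < 1 \<Longrightarrow> t > 0 \<Longrightarrow> h_a \<rho> x t > 0"
  using quadratic_form_pos[of \<rho> x] one_minus_square_pos[of \<rho>] by (simp add: h_a_def)

lemma bivariate_normal_density_on_ray:
  assumes t: "t > 0" and \<rho>: "\<bar>\<rho>\<bar> < 1"
  shows "bivariate_normal_density (vector [\<nu>v, \<nu>w]) (t *\<^sub>R vector [vector [1, \<rho>], vector [\<rho>, 1]]) (y, x * y)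
    = exp (- h_c \<nu>v \<nu>w \<rho> t) / (2 * pi * sqrt (h_d \<rho> t)) * exp (- h_a \<rho> x t * y^2 + 2 * h_b \<nu>v \<nu>w \<rho> x t * y)"
proof -
  have "1 - \<rho>^2 \<noteq> 0" "t \<noteq> 0" using one_minus_square_pos[OF \<rho>] t by auto
  then have "- ((y - \<nu>v)^2 - 2 * \<rho> * (y - \<nu>v) * (x * y - \<nu>w) + (x * y - \<nu>w)^2) / (2 * (1 - \<rho>^2) * t)
     = - h_c \<nu>v \<nu>w \<rho> t + (- h_a \<rho> x t * y^2 + 2 * h_b \<nu>v \<nu>w \<rho> x t * y)"
    unfolding h_a_def h_b_def h_c_def
    by (simp add: divide_simps) (simp add: algebra_simps power2_eq_square)
  then show ?thesis
    unfolding bivariate_normal_density_equicorrelated[OF assms] h_d_def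
    by (simp only: exp_add) simp
qed

text \<open>Along the ray of slope \<open>x\<close> the joint density is, as a function of the first coordinate, the
  exponential of a quadratic polynomial with coefficients \<open>a\<close>, \<open>b\<close>, \<open>c\<close>, so that
  \<open>nn_integral_abs_gaussian\<close> integrates it against \<open>\<bar>v\<bar>\<close>.\<close>

lemma distributed_ratio_density:
  assumes t: "t > 0" and \<rho>: "\<bar>\<rho>\<bar> < 1"
    and VW: "jointly_gaussian2 M V W (vector [\<nu>v, \<nu>w]) (t *\<^sub>R vector [vector [1, \<rho>], vector [\<rho>, 1]])"
  shows "distributed M lborel (\<lambda>\<omega>. W \<omega> / V \<omega>) (\<lambda>x. ennreal (ratio_density \<nu>v \<nu>w \<rho> x t))"
proof -
  let ?f = "bivariate_normal_density (vector [\<nu>v, \<nu>w]) (t *\<^sub>R vector [vector [1, \<rho>], vector [\<rho>, 1]])"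
  have "(\<integral>\<^sup>+y. ennreal \<bar>y\<bar> * ennreal (?f (y, x * y)) \<partial>lborel) = ennreal (ratio_density \<nu>v \<nu>w \<rho> x t)" for x
  proof -
    let ?K = "exp (- h_c \<nu>v \<nu>w \<rho> t) / (2 * pi * sqrt (h_d \<rho> t))"
    have K: "?K \<ge> 0" by (simp add: h_d_def less_imp_le[OF one_minus_square_pos[OF \<rho>], simplified])
    have "(\<integral>\<^sup>+y. ennreal \<bar>y\<bar> * ennreal (?f (y, x * y)) \<partial>lborel)
      = (\<integral>\<^sup>+y. ennreal ?K * ennreal (\<bar>y\<bar> * exp (- h_a \<rho> x t * y^2 + 2 * h_b \<nu>v \<nu>w \<rho> x t * y)) \<partial>lborel)"
      unfolding bivariate_normal_density_on_ray[OF t \<rho>]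
      using K by (intro nn_integral_cong) (simp add: ennreal_mult'[symmetric] mult_ac)
    also have "\<dots> = ennreal ?K * ennreal (hyp1F1 1 (1/2) ((h_b \<nu>v \<nu>w \<rho> x t)^2 / h_a \<rho> x t) / h_a \<rho> x t)"
      unfolding nn_integral_abs_gaussian[OF h_a_pos[OF \<rho> t], symmetric]
      by (rule nn_integral_cmult) measurable
    also have "\<dots> = ennreal (ratio_density \<nu>v \<nu>w \<rho> x t)"
      using K by (simp add: ennreal_mult'[symmetric] ratio_density_def mult_ac)
    finally show ?thesis .
  qed
  moreover have "distributed M lborel (\<lambda>\<omega>. (V \<omega>, W \<omega>)) (\<lambda>z. ennreal (?f z))"
    using VW by (simp add: jointly_gaussian2_def)
  from distributed_ratio[OF this]
  have "distributed M lborel (\<lambda>\<omega>. W \<omega> / V \<omega>) (\<lambda>x. \<integral>\<^sup>+y. ennreal \<bar>y\<bar> * ennreal (?f (y, x * y)) \<partial>lborel)" .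
  ultimately show ?thesis by simp
qed

section \<open>Derivatives of the density and the differential equation\<close>

text \<open>The numerators of \<open>a\<close> and \<open>b\<close>; the argument of the hypergeometric function is then
  \<open>lform\<^sup>2 / (2 (1 - \<rho>\<^sup>2) t qform)\<close>.\<close>

definition qform :: "real \<Rightarrow> real \<Rightarrow> real" where
  "qform \<rho> x = 1 - 2*\<rho>*x + x^2"

definition lform :: "real \<Rightarrow> real \<Rightarrow> real \<Rightarrow> real \<Rightarrow> real" where
  "lform \<nu>v \<nu>w \<rho> x = \<nu>v - \<rho>*\<nu>w + (\<nu>w - \<rho>*\<nu>v)*x"

definition kummer_arg :: "real \<Rightarrow> real \<Rightarrow> real \<Rightarrow> real \<Rightarrow> real \<Rightarrow> real" where
  "kummer_arg \<nu>v \<nu>w \<rho> t x = (lform \<nu>v \<nu>w \<rho> x)^2 / (2 * (1 - \<rho>^2) * t * qform \<rho> x)"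

text \<open>The density is the product of an amplitude, which depends on \<open>t\<close> only, and this profile, which
  carries all the dependence on \<open>x\<close>.\<close>

definition profile :: "real \<Rightarrow> real \<Rightarrow> real \<Rightarrow> real \<Rightarrow> real \<Rightarrow> real" where
  "profile \<nu>v \<nu>w \<rho> t x = hyp1F1 1 (1/2) (kummer_arg \<nu>v \<nu>w \<rho> t x) / qform \<rho> x"

definition amplitude :: "real \<Rightarrow> real \<Rightarrow> real \<Rightarrow> real \<Rightarrow> real" where
  "amplitude \<nu>v \<nu>w \<rho> t = sqrt (1 - \<rho>^2) / pi * exp (- h_c \<nu>v \<nu>w \<rho> t)"

context
  fixes \<nu>v \<nu>w \<rho> :: real
  assumes \<rho>: "\<bar>\<rho>\<bar> < 1"
begin

private abbreviation (input) "A \<equiv> qform \<rho>"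
private abbreviation (input) "B \<equiv> lform \<nu>v \<nu>w \<rho>"
private abbreviation (input) "r \<equiv> 1 - \<rho>^2"
private abbreviation (input) "m x \<equiv> \<nu>w - \<nu>v * x"
private abbreviation (input) "z \<equiv> kummer_arg \<nu>v \<nu>w \<rho>"
private abbreviation (input) "F \<equiv> hyp1F1 1 (1/2)"
private abbreviation (input) "F' \<equiv> hyp1F1_d1 1 (1/2)"
private abbreviation (input) "F'' \<equiv> hyp1F1_d2 1 (1/2)"

lemma qform_nz: "A x \<noteq> 0"
  using quadratic_form_pos[OF \<rho>, of x] by (simp add: qform_def)

lemma one_minus_square_nz: "r \<noteq> 0"
  using one_minus_square_pos[OF \<rho>] by simp

lemma ratio_density_profile:
  assumes "t > 0"
  shows "ratio_density \<nu>v \<nu>w \<rho> x t = amplitude \<nu>v \<nu>w \<rho> t * profile \<nu>v \<nu>w \<rho> t x"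
proof -
  have arg: "(h_b \<nu>v \<nu>w \<rho> x t)^2 / h_a \<rho> x t = z t x"
    using assms one_minus_square_nz qform_nz[of x]
    by (simp add: h_a_def h_b_def kummer_arg_def qform_def lform_def power2_eq_square divide_simps)
  moreover have "sqrt (h_d \<rho> t) = sqrt r * t"
    using assms by (simp add: h_d_def real_sqrt_mult)
  moreover have "h_a \<rho> x t = A x / (2 * (sqrt r * sqrt r) * t)"
    using one_minus_square_pos[OF \<rho>] by (simp add: h_a_def qform_def)
  moreover have "1 / (2 * pi * (s * t) * (A x / (2 * (s * s) * t))) = s / pi / A x" if "s > 0" for s
    using that assms qform_nz[of x] by (simp add: divide_simps)
  from this[of "sqrt r"]
  have "1 / (2 * pi * (sqrt r * t) * (A x / (2 * (sqrt r * sqrt r) * t))) = sqrt r / pi / A x"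
    using one_minus_square_pos[OF \<rho>] by simp
  ultimately have norm: "1 / (2 * pi * sqrt (h_d \<rho> t) * h_a \<rho> x t) = sqrt r / pi / A x"
    by simp
  have "exp (- h_c \<nu>v \<nu>w \<rho> t) / (2 * pi * sqrt (h_d \<rho> t) * h_a \<rho> x t)
      = exp (- h_c \<nu>v \<nu>w \<rho> t) * (1 / (2 * pi * sqrt (h_d \<rho> t) * h_a \<rho> x t))"
    by simp
  also have "\<dots> = amplitude \<nu>v \<nu>w \<rho> t / A x"
    unfolding norm by (simp add: amplitude_def)
  finally show ?thesis
    by (simp add: ratio_density_def profile_def arg)
qed

lemma qform_deriv: "(A has_real_derivative 2 * (x - \<rho>)) (at x)"
  unfolding qform_def[abs_def] by (auto intro!: derivative_eq_intros)

lemma lform_deriv: "(B has_real_derivative \<nu>w - \<rho> * \<nu>v) (at x)"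
  unfolding lform_def[abs_def] by (auto intro!: derivative_eq_intros)

text \<open>The quotient rule for \<open>B\<^sup>2 / A\<close> produces \<open>B (2 B' A - B A') / A\<^sup>2\<close>; the quadratic terms of the
  second factor cancel, and what remains is a multiple of \<open>\<nu>w - \<nu>v x\<close>.\<close>

lemma lform_slope_identity: "2 * (\<nu>w - \<rho> * \<nu>v) * A x - B x * (2 * (x - \<rho>)) = 2 * r * m x"
  by (simp add: qform_def lform_def power2_eq_square algebra_simps)

lemma kummer_arg_deriv:
  assumes "t > 0"
  shows "(z t has_real_derivative B x * m x / (t * (A x)^2)) (at x)"
proof -
  have "(z t has_real_derivative
      (2 * B x * (\<nu>w - \<rho> * \<nu>v) * (2 * r * t * A x) - (B x)^2 * (2 * r * t * (2 * (x - \<rho>)))) / (2 * r * t * A x)^2) (at x)"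
    unfolding kummer_arg_def[abs_def]
    using one_minus_square_nz qform_nz assms
    by (auto intro!: derivative_eq_intros lform_deriv qform_deriv simp: power2_eq_square)
  moreover have "(2 * B x * (\<nu>w - \<rho> * \<nu>v) * (2 * r * t * A x) - (B x)^2 * (2 * r * t * (2 * (x - \<rho>))))
      = 2 * r * t * B x * (2 * (\<nu>w - \<rho> * \<nu>v) * A x - B x * (2 * (x - \<rho>)))"
    by (simp add: power2_eq_square algebra_simps)
  moreover have "2 * r * t * B x * (2 * r * m x) / (2 * r * t * A x)^2 = B x * m x / (t * (A x)^2)"
    using one_minus_square_nz assms by (simp add: divide_simps power2_eq_square)
  ultimately show ?thesis
    unfolding lform_slope_identity by simp
qed

definition profile_x :: "real \<Rightarrow> real \<Rightarrow> real" where
  "profile_x t x = F' (z t x) * (B x * m x / (t * (A x)^3)) - F (z t x) * (2 * (x - \<rho>) / (A x)^2)"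

definition profile_xx :: "real \<Rightarrow> real \<Rightarrow> real" where
  "profile_xx t x =
     F'' (z t x) * ((B x * m x)^2 / (t^2 * (A x)^5))
     + F' (z t x) * ((((\<nu>w - \<rho> * \<nu>v) * m x - \<nu>v * B x) * A x - 8 * B x * m x * (x - \<rho>)) / (t * (A x)^4))
     + F (z t x) * ((8 * (x - \<rho>)^2 - 2 * A x) / (A x)^3)"

lemma profile_deriv:
  assumes "t > 0"
  shows "(profile \<nu>v \<nu>w \<rho> t has_real_derivative profile_x t x) (at x)"
proof -
  note [derivative_intros] = DERIV_chain2[OF hyp1F1_deriv kummer_arg_deriv[OF assms]] qform_deriv
  show ?thesis
    unfolding profile_def[abs_def] profile_x_def
    by (rule derivative_eq_intros refl | use qform_nz assms in \<open>simp add: divide_simps power2_eq_square power3_eq_cube\<close>)+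
qed

lemma profile_x_deriv:
  assumes "t > 0"
  shows "(profile_x t has_real_derivative profile_xx t x) (at x)"
proof -
  have A: "(A has_real_derivative 2 * (x - \<rho>)) (at x)" by (rule qform_deriv)
  have F: "((\<lambda>y. F (z t y)) has_real_derivative F' (z t x) * (B x * m x / (t * (A x)^2))) (at x)"
    by (rule DERIV_chain2[OF hyp1F1_deriv kummer_arg_deriv[OF assms]]) auto
  have F': "((\<lambda>y. F' (z t y)) has_real_derivative F'' (z t x) * (B x * m x / (t * (A x)^2))) (at x)"
    by (rule DERIV_chain2[OF hyp1F1_deriv2 kummer_arg_deriv[OF assms]]) auto
  have 1: "((\<lambda>y. B y * m y / (t * (A y)^3)) has_real_derivative
      (((\<nu>w - \<rho> * \<nu>v) * m x - \<nu>v * B x) * A x - 6 * B x * m x * (x - \<rho>)) / (t * (A x)^4)) (at x)"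
    using assms qform_nz[of x]
    by (auto intro!: derivative_eq_intros qform_deriv lform_deriv)
      (simp add: divide_simps, simp add: algebra_simps eval_nat_numeral)
  have 2: "((\<lambda>y. 2 * (y - \<rho>) / (A y)^2) has_real_derivative
      (2 * A x - 8 * (x - \<rho>)^2) / (A x)^3) (at x)"
    using assms qform_nz[of x]
    by (auto intro!: derivative_eq_intros qform_deriv)
      (simp add: divide_simps, simp add: algebra_simps eval_nat_numeral)
  show ?thesis
    unfolding profile_x_def[abs_def] profile_xx_def
    by (rule DERIV_cong[OF DERIV_diff[OF DERIV_mult[OF F' 1] DERIV_mult[OF F 2]]])
      (use assms qform_nz[of x] in \<open>simp add: divide_simps, simp add: algebra_simps eval_nat_numeral\<close>)
qed

lemma profile_t_deriv:
  assumes "t > 0"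
  shows "((\<lambda>s. profile \<nu>v \<nu>w \<rho> s x) has_real_derivative - (z t x * F' (z t x) / (t * A x))) (at t)"
proof -
  have zt: "((\<lambda>s. z s x) has_real_derivative - (z t x / t)) (at t)"
    unfolding kummer_arg_def using assms one_minus_square_nz qform_nz[of x]
    by (auto intro!: derivative_eq_intros simp: divide_simps)
  have "((\<lambda>s. F (z s x)) has_real_derivative F' (z t x) * - (z t x / t)) (at t)"
    by (rule DERIV_chain2[OF hyp1F1_deriv zt]) auto
  from DERIV_cdivide[OF this, of "A x"] show ?thesis
    unfolding profile_def by (simp add: mult_ac)
qed

lemma amplitude_deriv:
  assumes "t > 0"
  shows "(amplitude \<nu>v \<nu>w \<rho> has_real_derivative amplitude \<nu>v \<nu>w \<rho> t * (h_c \<nu>v \<nu>w \<rho> t / t)) (at t)"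
proof -
  have "(h_c \<nu>v \<nu>w \<rho> has_real_derivative - (h_c \<nu>v \<nu>w \<rho> t / t)) (at t)"
    unfolding h_c_def[abs_def] using assms one_minus_square_nz
    by (auto intro!: derivative_eq_intros simp: divide_simps)
  then show ?thesis
    unfolding amplitude_def[abs_def] by (auto intro!: derivative_eq_intros simp: mult_ac)
qed

text \<open>The coefficient polynomials expressed through the numerators \<open>A\<close> and \<open>B\<close>, the slope
  \<open>B' = \<nu>w - \<rho> \<nu>v\<close> and \<open>m x = \<nu>w - \<nu>v x\<close>. In these terms the two identities for \<open>Q2\<close>
  below are what the coefficients of \<open>F\<close> and of \<open>F'\<close> in the differential equation require at first
  order in \<open>t\<close>.\<close>

lemma P3_factor: "P3 \<nu>v \<nu>w \<rho> x = (A x)^2 * (2 * r * m x - A x * (\<nu>w - \<rho> * \<nu>v))"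
  by (simp add: P3_def qform_def) algebra

lemma P1_factor: "P1 \<nu>v \<nu>w \<rho> x = - 2 * r * (m x)^2 * B x"
  by (simp add: P1_def lform_def) algebra

definition P2_cofactor :: "real \<Rightarrow> real" where
  "P2_cofactor x = \<nu>w * (\<rho> - x) * (3*x^2 - 6*x*\<rho> + 11*\<rho>^2 - 8)
      + \<nu>v * (2 - 9*x^2 + 10*x*\<rho> + 3*x^3*\<rho> - 5*\<rho>^2 - x*\<rho>^3)"

lemma P2_factor: "P2 \<nu>v \<nu>w \<rho> x = A x * P2_cofactor x"
  by (simp add: P2_def qform_def P2_cofactor_def)

lemma Q1_factor: "Q1 \<nu>v \<nu>w \<rho> x = 2 * r * (m x)^2 * (\<nu>w - \<rho> * \<nu>v)"
  by (simp add: Q1_def)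

lemma Q2_first_identity:
  "Q2 \<nu>v \<nu>w \<rho> x = (2 * r * m x - A x * (\<nu>w - \<rho> * \<nu>v)) * (8 * (x - \<rho>)^2 - 2 * A x) - 2 * (x - \<rho>) * P2_cofactor x"
  unfolding Q2_def qform_def P2_cofactor_def by algebra

lemma Q2_second_identity:
  "(B x)^2 * Q2 \<nu>v \<nu>w \<rho> x = 2 * r * ((2 * r * m x - A x * (\<nu>w - \<rho> * \<nu>v)) *
      (r * (m x)^2 - ((\<nu>w - \<rho> * \<nu>v) * m x - \<nu>v * B x) * A x + 8 * B x * m x * (x - \<rho>)) - P2_cofactor x * B x * m x)"
  unfolding Q2_def qform_def P2_cofactor_def lform_def by algebra

text \<open>The differential equation in the form that remains after dividing by the amplitude and clearing
  the denominator \<open>Q\<close>. Kummer's equation eliminates \<open>F''\<close>, because the square of the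
  derivative of the argument contains the argument as a factor. What is left is linear in \<open>F\<close> and \<open>F'\<close>, and
  the coefficients agree separately. As polynomials in \<open>t\<close>, they agree at order zero by the slope
  identity and the factorisation of \<open>P3\<close>, and at order one by the two identities for \<open>Q2\<close>.\<close>

lemma profile_pde:
  fixes t x :: real
  assumes t: "t > 0"
  defines "Q \<equiv> Q1 \<nu>v \<nu>w \<rho> x + t * Q2 \<nu>v \<nu>w \<rho> x"
  shows "Q * ((F (z t x) - z t x * F' (z t x)) / A x)
    = t * P3 \<nu>v \<nu>w \<rho> x * profile_xx t x + (P1 \<nu>v \<nu>w \<rho> x + t * P2 \<nu>v \<nu>w \<rho> x) * profile_x t x"
proof -
  define a b n y s \<zeta> where abs: "a = A x" "b = B x" "n = m x" "y = x - \<rho>" "s = r" "\<zeta> = z t x"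
  define l p3 where l: "l = \<nu>w - \<rho> * \<nu>v" and p3: "p3 = 2 * s * n - a * l"
  define f f' f'' where f: "f = F \<zeta>" "f' = F' \<zeta>" "f'' = F'' \<zeta>"
  have nz: "a \<noteq> 0" "s \<noteq> 0" "t \<noteq> 0"
    using qform_nz one_minus_square_nz t by (auto simp: abs)
  have \<zeta>: "\<zeta> = b^2 / (2 * s * t * a)"
    by (simp add: abs kummer_arg_def)
  have slope: "2 * l * a - 2 * b * y = 2 * s * n"
    using lform_slope_identity[of x] by (simp add: abs l algebra_simps)
  have P: "P1 \<nu>v \<nu>w \<rho> x = - 2 * s * n^2 * b" "P2 \<nu>v \<nu>w \<rho> x = a * P2_cofactor x" "P3 \<nu>v \<nu>w \<rho> x = a^2 * p3"
    by (simp_all add: P1_factor P2_factor P3_factor abs l p3)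
  have Q1: "Q1 \<nu>v \<nu>w \<rho> x = 2 * s * n^2 * l"
    by (simp add: Q1_factor abs l)
  have Q2: "Q2 \<nu>v \<nu>w \<rho> x = p3 * (8 * y^2 - 2 * a) - 2 * y * P2_cofactor x"
    by (simp add: Q2_first_identity abs l p3)
  have Q2': "b^2 * Q2 \<nu>v \<nu>w \<rho> x = 2 * s * (p3 * (s * n^2 - (l * n - \<nu>v * b) * a + 8 * b * n * y) - P2_cofactor x * b * n)"
    unfolding abs l p3 by (rule Q2_second_identity)
  have ux: "profile_x t x = f' * (b * n / (t * a^3)) - f * (2 * y / a^2)"
    by (simp add: profile_x_def abs f)
  have uxx: "profile_xx t x = f'' * ((b * n)^2 / (t^2 * a^5))
     + f' * (((l * n - \<nu>v * b) * a - 8 * b * n * y) / (t * a^4)) + f * ((8 * y^2 - 2 * a) / a^3)"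
    by (simp add: profile_xx_def abs f l)
  \<comment> \<open>\<open>F''\<close> comes with a factor \<open>b\<^sup>2\<close>, which supplies the factor \<open>\<zeta>\<close> that Kummer's equation needs.\<close>
  have "\<zeta> * f'' = f + (\<zeta> - 1/2) * f'"
    using kummer_ode[of 1 "1/2" \<zeta>] by (simp add: f)
  moreover have "f'' * ((b * n)^2 / (t^2 * a^5)) = 2 * s * n^2 / (t * a^4) * (\<zeta> * f'')"
    unfolding \<zeta> using nz by (simp add: divide_simps eval_nat_numeral)
  ultimately have kummer: "f'' * ((b * n)^2 / (t^2 * a^5)) = 2 * s * n^2 / (t * a^4) * (f + (\<zeta> - 1/2) * f')"
    by simp
  have coeff_f: "Q / a = t * (a^2 * p3) * (2 * s * n^2 / (t * a^4) + (8 * y^2 - 2 * a) / a^3)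
      - (- 2 * s * n^2 * b + t * (a * P2_cofactor x)) * (2 * y / a^2)"
  proof -
    have "2 * s * n^2 * (p3 + 2 * b * y) = a * Q1 \<nu>v \<nu>w \<rho> x"
      using slope unfolding Q1 p3 by algebra
    with Q2 show ?thesis
      unfolding Q_def using nz by (simp add: divide_simps) algebra
  qed
  have coeff_f': "- Q * \<zeta> / a = t * (a^2 * p3) * (2 * s * n^2 / (t * a^4) * (\<zeta> - 1/2)
        + ((l * n - \<nu>v * b) * a - 8 * b * n * y) / (t * a^4))
      + (- 2 * s * n^2 * b + t * (a * P2_cofactor x)) * (b * n / (t * a^3))"
  proof -
    have "2 * s * n^2 * b^2 * (p3 - 2 * s * n) = - a * (b^2 * Q1 \<nu>v \<nu>w \<rho> x)"
      unfolding Q1 p3 by algebra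
    with Q2' show ?thesis
      unfolding Q_def \<zeta> using nz by (simp add: divide_simps) algebra
  qed
  have regroup: "(T * (c + k) - R * j) * f + (T * (c * e + g) + R * h) * f'
      = T * (c * (f + e * f') + f' * g + f * k) + R * (f' * h - f * j)" for T R c e g h j k :: real
    by (simp add: algebra_simps)
  have "Q * ((f - \<zeta> * f') / a) = Q / a * f + (- Q * \<zeta> / a) * f'"
    by (simp add: diff_divide_distrib algebra_simps)
  also have "\<dots> = t * P3 \<nu>v \<nu>w \<rho> x * profile_xx t x + (P1 \<nu>v \<nu>w \<rho> x + t * P2 \<nu>v \<nu>w \<rho> x) * profile_x t x"
    unfolding coeff_f coeff_f' P ux uxx kummer by (rule regroup)
  finally show ?thesis
    unfolding f abs .
qed

end

lemma coefficient_polynomials_differentiable: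
  "P3 \<nu>v \<nu>w \<rho> differentiable (at x)"
  "Q1 \<nu>v \<nu>w \<rho> differentiable (at x)"
  "Q2 \<nu>v \<nu>w \<rho> differentiable (at x)"
  unfolding P3_def[abs_def] Q1_def[abs_def] Q2_def[abs_def]
  by (intro derivative_intros differentiable_ident)+

text \<open>Since \<open>c\<close> is inversely proportional to \<open>t\<close>, the quotient \<open>c / t\<close> is the logarithmic derivative of
  the amplitude; \<open>S\<close> accounts for it up to the term \<open>1 / t\<close>, which pairs with the profile.\<close>

lemma coeff_S_eq:
  assumes "\<bar>\<rho>\<bar> < 1" "t > 0"
  shows "coeff_S \<nu>v \<nu>w \<rho> t = (h_c \<nu>v \<nu>w \<rho> t - 1) / t"
proof -
  define r q where "r = 1 - \<rho>^2" and "q = sqrt r"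
  have r: "r > 0" "q > 0" "\<rho>^2 - 1 = - r"
    using one_minus_square_pos[OF assms(1)] by (auto simp: r_def q_def)
  have "r powr (3/2) = r powr (1 + 1/2)" by simp
  also have "\<dots> = r * q"
    unfolding powr_add using r by (simp add: powr_half_sqrt q_def)
  finally have "coeff_S \<nu>v \<nu>w \<rho> t = (\<nu>v^2 + \<nu>w^2 - 2*\<nu>v*\<nu>w*\<rho> + 2*t*(- r)) / (2 * t^3 * (r * q)) * (q * t)"
    using assms(2) unfolding coeff_S_def r(3) r_def[symmetric] by (simp add: real_sqrt_mult q_def)
  also have "\<dots> = ((\<nu>v^2 - 2*\<rho>*\<nu>w*\<nu>v + \<nu>w^2) / (2 * r * t) - 1) / t"
    using r assms(2) by (simp add: divide_simps) (simp add: algebra_simps eval_nat_numeral)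
  finally show ?thesis
    by (simp add: h_c_def r_def)
qed

lemma ratio_density_x_deriv:
  assumes "\<bar>\<rho>\<bar> < 1" "t > 0"
  shows "((\<lambda>y. ratio_density \<nu>v \<nu>w \<rho> y t) has_real_derivative
    amplitude \<nu>v \<nu>w \<rho> t * profile_x \<nu>v \<nu>w \<rho> t x) (at x)"
  unfolding ratio_density_profile[OF assms]
  by (rule DERIV_cmult[OF profile_deriv[OF assms]])

lemma ratio_density_t_deriv:
  fixes \<nu>v \<nu>w \<rho> x t :: real
  assumes "\<bar>\<rho>\<bar> < 1" "t > 0"
  defines "\<zeta> \<equiv> kummer_arg \<nu>v \<nu>w \<rho> t x"
  shows "((\<lambda>s. ratio_density \<nu>v \<nu>w \<rho> x s) has_real_derivative
    amplitude \<nu>v \<nu>w \<rho> t * ((hyp1F1 1 (1/2) \<zeta> - \<zeta> * hyp1F1_d1 1 (1/2) \<zeta>) / (t * qform \<rho> x))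
    + coeff_S \<nu>v \<nu>w \<rho> t * ratio_density \<nu>v \<nu>w \<rho> x t) (at t)"
proof -
  have "((\<lambda>s. amplitude \<nu>v \<nu>w \<rho> s * profile \<nu>v \<nu>w \<rho> s x) has_real_derivative
     amplitude \<nu>v \<nu>w \<rho> t * (h_c \<nu>v \<nu>w \<rho> t / t) * profile \<nu>v \<nu>w \<rho> t x
     + - (\<zeta> * hyp1F1_d1 1 (1/2) \<zeta> / (t * qform \<rho> x)) * amplitude \<nu>v \<nu>w \<rho> t) (at t)"
    unfolding \<zeta>_def by (rule DERIV_mult[OF amplitude_deriv[OF assms(1,2)] profile_t_deriv[OF assms(1,2)]])
  then have "((\<lambda>s. ratio_density \<nu>v \<nu>w \<rho> x s) has_real_derivative
     amplitude \<nu>v \<nu>w \<rho> t * (h_c \<nu>v \<nu>w \<rho> t / t) * profile \<nu>v \<nu>w \<rho> t x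
     + - (\<zeta> * hyp1F1_d1 1 (1/2) \<zeta> / (t * qform \<rho> x)) * amplitude \<nu>v \<nu>w \<rho> t) (at t)"
    by (rule has_field_derivative_transform_within_open[of _ _ _ "{0<..}"])
      (use assms in \<open>auto simp: ratio_density_profile\<close>)
  then show ?thesis
    by (rule DERIV_cong)
      (use qform_nz[OF assms(1), of x] assms(2) in
        \<open>simp add: coeff_S_eq ratio_density_profile assms(1) profile_def \<zeta>_def divide_simps,
         simp add: algebra_simps\<close>)
qed

text \<open>The terms of \<open>C\<close> that contain the derivatives of \<open>P3\<close>, \<open>Q1\<close> and \<open>Q2\<close> are \<open>- \<partial>D/\<partial>x\<close>. Hence
  the flux term and the drift term together have the second-order coefficient \<open>D = P3 / Q\<close> and the
  first-order coefficient \<open>(P1 + t P2) / (t Q)\<close>.\<close>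

lemma flux_deriv:
  fixes \<nu>v \<nu>w \<rho> x t :: real
  assumes \<rho>: "\<bar>\<rho>\<bar> < 1" and t: "t > 0"
  defines "Q \<equiv> Q1 \<nu>v \<nu>w \<rho> x + t * Q2 \<nu>v \<nu>w \<rho> x"
  assumes nz: "Q \<noteq> 0"
  shows "((\<lambda>y. coeff_D \<nu>v \<nu>w \<rho> y t * deriv (\<lambda>z. ratio_density \<nu>v \<nu>w \<rho> z t) y) has_real_derivative
    amplitude \<nu>v \<nu>w \<rho> t *
      (P3 \<nu>v \<nu>w \<rho> x * profile_xx \<nu>v \<nu>w \<rho> t x
        + (P1 \<nu>v \<nu>w \<rho> x + t * P2 \<nu>v \<nu>w \<rho> x) / t * profile_x \<nu>v \<nu>w \<rho> t x) / Q
    - coeff_C \<nu>v \<nu>w \<rho> x t * (amplitude \<nu>v \<nu>w \<rho> t * profile_x \<nu>v \<nu>w \<rho> t x)) (at x)"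
proof -
  let ?k = "amplitude \<nu>v \<nu>w \<rho> t"
  let ?u' = "profile_x \<nu>v \<nu>w \<rho> t" and ?u'' = "profile_xx \<nu>v \<nu>w \<rho> t"
  have deriv_h: "deriv (\<lambda>z. ratio_density \<nu>v \<nu>w \<rho> z t) y = ?k * ?u' y" for y
    by (rule DERIV_imp_deriv[OF ratio_density_x_deriv[OF \<rho> t]])
  let ?p = "deriv (P3 \<nu>v \<nu>w \<rho>) x" and ?q = "deriv (Q1 \<nu>v \<nu>w \<rho>) x + t * deriv (Q2 \<nu>v \<nu>w \<rho>) x"
  note d = coefficient_polynomials_differentiable[THEN DERIV_deriv_iff_real_differentiable[THEN iffD2]]
  have Q: "((\<lambda>y. Q1 \<nu>v \<nu>w \<rho> y + t * Q2 \<nu>v \<nu>w \<rho> y) has_real_derivative ?q) (at x)"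
    by (intro DERIV_add DERIV_cmult d)
  have D: "((\<lambda>y. coeff_D \<nu>v \<nu>w \<rho> y t) has_real_derivative (?p * Q - P3 \<nu>v \<nu>w \<rho> x * ?q) / (Q * Q)) (at x)"
    unfolding coeff_D_def Q_def using nz by (intro DERIV_divide d Q) (simp add: Q_def)
  have C: "coeff_C \<nu>v \<nu>w \<rho> x t = (P1 \<nu>v \<nu>w \<rho> x + t * P2 \<nu>v \<nu>w \<rho> x) / (t * Q) - ?p / Q + P3 \<nu>v \<nu>w \<rho> x * ?q / Q^2"
    by (simp add: coeff_C_def Q_def)
  have D_eq: "coeff_D \<nu>v \<nu>w \<rho> x t = P3 \<nu>v \<nu>w \<rho> x / Q"
    by (simp add: coeff_D_def Q_def)
  have "(p * Q - p3 * q) / (Q * Q) * (k * u') + k * u'' * (p3 / Q)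
      = k * (p3 * u'' + c / t * u') / Q - (c / (t * Q) - p / Q + p3 * q / Q^2) * (k * u')"
    for p p3 q k u' u'' c :: real
    using nz t by (simp add: divide_simps) (simp add: algebra_simps power2_eq_square)
  note regroup = this
  show ?thesis
    unfolding deriv_h
    by (rule DERIV_cong[OF DERIV_mult[OF D DERIV_cmult[OF profile_x_deriv[OF \<rho> t]]]])
      (simp only: C D_eq regroup)
qed

section \<open>Zeros of the cubic\<close>

text \<open>Replacing the polynomial by its negative if necessary, its leading coefficient is positive. The
  reflection \<open>- q (- x)\<close> has the same leading coefficient because the degree is odd, so both it and
  \<open>q\<close> are positive far to the right, and the intermediate value theorem applies.\<close>

lemma odd_degree_has_real_root:
  fixes p :: "real poly"
  assumes "odd (degree p)"
  shows "\<exists>x. poly p x = 0"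
proof -
  have pos: "\<exists>x. poly q x = 0" if q: "odd (degree q)" "lead_coeff q > 0" for q :: "real poly"
  proof -
    have pos_at_top: "\<exists>b. \<forall>x\<ge>b. poly f x > 0" if "lead_coeff f > 0" for f :: "real poly"
      using poly_pinfty_gt_lc[OF that] that by (meson less_le_trans)
    let ?q = "- (q \<circ>\<^sub>p [:0, -1:])"
    have "lead_coeff (q \<circ>\<^sub>p [:0, -1:]) = - lead_coeff q"
      using q(1) by (subst lead_coeff_comp) auto
    then have "lead_coeff ?q > 0"
      using q(2) by (simp only: lead_coeff_minus)
    then obtain a b where a: "\<forall>x\<ge>a. poly ?q x > 0" and b: "\<forall>x\<ge>b. poly q x > 0"
      using pos_at_top q(2) by blast
    define c where "c = max 1 (max a b)"
    have "poly q (- c) < 0" "poly q c > 0" "- c < c"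
      using a[rule_format, of c] b[rule_format, of c] by (auto simp: c_def poly_pcompose)
    then show ?thesis
      using poly_IVT_pos[of "- c" c q] by auto
  qed
  show ?thesis
  proof (cases "lead_coeff p > 0")
    case False
    then have "lead_coeff (- p) > 0"
      using assms by (cases "p = 0") (auto simp: not_less le_less)
    from pos[OF _ this] assms show ?thesis by auto
  qed (use pos assms in auto)
qed

lemma card_roots_of_cubic:
  fixes p :: "real poly"
  assumes "degree p = 3"
  shows "card {x. poly p x = 0} \<in> {1, 2, 3}"
proof -
  have "p \<noteq> 0" using assms by auto
  then have "finite {x. poly p x = 0}" "card {x. poly p x = 0} \<le> 3"
    using card_poly_roots_bound[of p] assms by (auto intro: poly_roots_finite)
  moreover have "{x. poly p x = 0} \<noteq> {}"
    using odd_degree_has_real_root[of p] assms by auto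
  ultimately have "card {x. poly p x = 0} \<noteq> 0" "card {x. poly p x = 0} \<le> 3"
    by auto
  then show ?thesis by auto
qed

definition Q_poly :: "real \<Rightarrow> real \<Rightarrow> real \<Rightarrow> real \<Rightarrow> real poly" where
  "Q_poly \<nu>v \<nu>w \<rho> t = smult (2 * (1 - \<rho>^2))
     (smult (\<nu>w - \<nu>v * \<rho>) ([:\<nu>w, - \<nu>v:]^2)
      - smult t [:\<nu>w * (1 + 3 * \<rho>^2) - \<nu>v * \<rho>, - 8 * \<rho> * \<nu>w - \<nu>v * \<rho>^2, 4 * \<nu>w + 5 * \<nu>v * \<rho>, - 3 * \<nu>v:])"

lemma poly_Q_poly: "poly (Q_poly \<nu>v \<nu>w \<rho> t) x = Q1 \<nu>v \<nu>w \<rho> x + t * Q2 \<nu>v \<nu>w \<rho> x"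
  by (simp add: Q_poly_def Q1_def Q2_def power2_eq_square algebra_simps)

lemma degree_Q_poly:
  assumes "\<nu>v \<noteq> 0" "\<bar>\<rho>\<bar> < 1" "t > 0"
  shows "degree (Q_poly \<nu>v \<nu>w \<rho> t) = 3"
proof -
  have "\<rho>^2 \<noteq> 1" using assms(2) abs_square_less_1[of \<rho>] by simp
  then show ?thesis
    using assms by (simp add: Q_poly_def power2_eq_square eval_nat_numeral)
qed

text \<open>For \<open>\<nu>v = 1\<close> and \<open>\<rho> = 0\<close>, half of the cubic is
  \<open>3 t x\<^sup>3 + \<nu>w (1 - 4 t) x\<^sup>2 - 2 \<nu>w\<^sup>2 x + \<nu>w\<^sup>3 - t \<nu>w\<close>. Choosing \<open>t = 1/4\<close> and
  \<open>\<nu>w\<^sup>2 = t\<close> removes the quadratic and the constant term.\<close>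

lemma Q_zeros_three: "card (Q_zeros 1 (1/2) 0 (1/4)) = 3"
proof -
  define s where "s = sqrt (2/3 :: real)"
  have s: "s > 0" "s * s = 2/3" by (simp_all add: s_def)
  have "Q1 1 (1/2) 0 x + 1/4 * Q2 1 (1/2) 0 x = 3/2 * (x * (x - s) * (x + s))" for x
  proof -
    have "x * (x - s) * (x + s) = x^3 - (s * s) * x"
      by (simp add: algebra_simps eval_nat_numeral)
    then show ?thesis
      unfolding s by (simp add: Q1_def Q2_def algebra_simps eval_nat_numeral)
  qed
  then have "Q_zeros 1 (1/2) 0 (1/4) = {0, s, - s}"
    unfolding Q_zeros_def by (simp only:) (auto simp: eq_neg_iff_add_eq_0)
  then show ?thesis using s(1) by auto
qed

lemma Q_zeros_one: "card (Q_zeros 1 0 0 1) = 1"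
proof -
  have "Q_zeros 1 0 0 1 = {0}"
    by (auto simp: Q_zeros_def Q1_def Q2_def)
  then show ?thesis by simp
qed

text \<open>Let again \<open>\<nu>v = 1\<close> and \<open>\<rho> = 0\<close>. A double zero at \<open>s \<nu>w\<close> is a common zero of the cubic and its
  derivative; eliminating \<open>t\<close> leaves \<open>\<nu>w\<^sup>2 s (3 s\<^sup>2 - 9 s + 8) = - 2\<close>. The choice \<open>s = - 1\<close>
  gives \<open>\<nu>w\<^sup>2 = 1/10\<close> and \<open>t = 4/17\<close>.\<close>

lemma Q_zeros_two: "card (Q_zeros 1 (1 / sqrt 10) 0 (4/17)) = 2"
proof -
  define w where "w = 1 / sqrt (10::real)"
  have w: "w > 0" "w * w = 1/10" by (simp_all add: w_def)
  have w3: "w * (w * y) = 1/10 * y" for y using w(2) by (metis mult.assoc)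
  have "Q1 1 w 0 x + 4/17 * Q2 1 w 0 x = 24/17 * ((x + w)^2 * (x - 23/12 * w))" for x
    by (simp add: Q1_def Q2_def algebra_simps eval_nat_numeral w w3)
  then have "Q_zeros 1 w 0 (4/17) = {- w, 23/12 * w}"
    unfolding Q_zeros_def by (simp only:) (auto simp: eq_neg_iff_add_eq_0)
  then have "card (Q_zeros 1 w 0 (4/17)) = 2"
    using w(1) by simp
  then show ?thesis by (simp only: w_def)
qed

section \<open>The evolution equation for the quotient density\<close>

theorem theorem2p4:
  fixes \<nu>v \<nu>w \<rho> :: real
  assumes "\<nu>v \<noteq> 0" and "\<bar>\<rho>\<bar> < 1"
  shows
    "(\<forall>t>0. \<forall>(M :: 'a measure) V W.
        jointly_gaussian2 M V W (vector [\<nu>v, \<nu>w]) (t *\<^sub>R vector [vector [1, \<rho>], vector [\<rho>, 1]])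
        \<longrightarrow> distributed M lborel (\<lambda>\<omega>. W \<omega> / V \<omega>) (\<lambda>x. ennreal (ratio_density \<nu>v \<nu>w \<rho> x t)))
     \<and> (\<forall>t>0. \<forall>x. (\<lambda>y. ratio_density \<nu>v \<nu>w \<rho> y t) differentiable (at x))
     \<and> (\<forall>t>0. \<forall>x. Q1 \<nu>v \<nu>w \<rho> x + t * Q2 \<nu>v \<nu>w \<rho> x \<noteq> 0 \<longrightarrow>
          (\<lambda>s. ratio_density \<nu>v \<nu>w \<rho> x s) differentiable (at t)
          \<and> (\<lambda>y. coeff_D \<nu>v \<nu>w \<rho> y t * deriv (\<lambda>z. ratio_density \<nu>v \<nu>w \<rho> z t) y) differentiable (at x)
          \<and> deriv (\<lambda>s. ratio_density \<nu>v \<nu>w \<rho> x s) t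
            = deriv (\<lambda>y. coeff_D \<nu>v \<nu>w \<rho> y t * deriv (\<lambda>z. ratio_density \<nu>v \<nu>w \<rho> z t) y) x
              + coeff_C \<nu>v \<nu>w \<rho> x t * deriv (\<lambda>y. ratio_density \<nu>v \<nu>w \<rho> y t) x
              + coeff_S \<nu>v \<nu>w \<rho> t * ratio_density \<nu>v \<nu>w \<rho> x t)
     \<and> (\<forall>t>0. (\<exists>p :: real poly. degree p = 3 \<and>
                  (\<forall>x. poly p x = Q1 \<nu>v \<nu>w \<rho> x + t * Q2 \<nu>v \<nu>w \<rho> x))
               \<and> card (Q_zeros \<nu>v \<nu>w \<rho> t) \<in> {1, 2, 3})
     \<and> (\<forall>k\<in>{1, 2, 3}. \<exists>v w r t. v \<noteq> 0 \<and> \<bar>r\<bar> < 1 \<and> t > 0 \<and> card (Q_zeros v w r t) = k)"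
proof (intro conjI allI impI)
  fix t :: real and M :: "'a measure" and V W
  assume "t > 0" and "jointly_gaussian2 M V W (vector [\<nu>v, \<nu>w]) (t *\<^sub>R vector [vector [1, \<rho>], vector [\<rho>, 1]])"
  then show "distributed M lborel (\<lambda>\<omega>. W \<omega> / V \<omega>) (\<lambda>x. ennreal (ratio_density \<nu>v \<nu>w \<rho> x t))"
    using assms(2) by (intro distributed_ratio_density)
next
  fix t x :: real
  assume t: "t > 0"
  note h_x = ratio_density_x_deriv[OF assms(2) t, of \<nu>v \<nu>w x]
  show "(\<lambda>y. ratio_density \<nu>v \<nu>w \<rho> y t) differentiable (at x)"
    using h_x by (auto simp: real_differentiable_def)
  assume Q: "Q1 \<nu>v \<nu>w \<rho> x + t * Q2 \<nu>v \<nu>w \<rho> x \<noteq> 0"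
  note h_t = ratio_density_t_deriv[OF assms(2) t, of \<nu>v \<nu>w x]
  note flux = flux_deriv[OF assms(2) t Q]
  show "(\<lambda>s. ratio_density \<nu>v \<nu>w \<rho> x s) differentiable (at t)"
    using h_t by (auto simp: real_differentiable_def)
  show "(\<lambda>y. coeff_D \<nu>v \<nu>w \<rho> y t * deriv (\<lambda>z. ratio_density \<nu>v \<nu>w \<rho> z t) y) differentiable (at x)"
    using flux by (auto simp: real_differentiable_def)
  let ?Q = "Q1 \<nu>v \<nu>w \<rho> x + t * Q2 \<nu>v \<nu>w \<rho> x"
  have "U / (t * A) = (T * X + S / t * Y) / ?Q"
    if "?Q * (U / A) = t * T * X + S * Y" for U A T X S Y :: real
  proof -
    have "U / (t * A) = ?Q * (U / A) / (t * ?Q)"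
      using Q by simp
    also have "\<dots> = (T * X + S / t * Y) / ?Q"
      unfolding that using Q t by (simp add: divide_simps)
    finally show ?thesis .
  qed
  from this[OF profile_pde[OF assms(2) t, of \<nu>v \<nu>w x]]
  show "deriv (\<lambda>s. ratio_density \<nu>v \<nu>w \<rho> x s) t
            = deriv (\<lambda>y. coeff_D \<nu>v \<nu>w \<rho> y t * deriv (\<lambda>z. ratio_density \<nu>v \<nu>w \<rho> z t) y) x
              + coeff_C \<nu>v \<nu>w \<rho> x t * deriv (\<lambda>y. ratio_density \<nu>v \<nu>w \<rho> y t) x
              + coeff_S \<nu>v \<nu>w \<rho> t * ratio_density \<nu>v \<nu>w \<rho> x t"
    unfolding DERIV_imp_deriv[OF h_t] DERIV_imp_deriv[OF flux] DERIV_imp_deriv[OF h_x] by simp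
next
  fix t :: real
  assume t: "t > 0"
  note deg = degree_Q_poly[OF assms t, of \<nu>w]
  show "\<exists>p :: real poly. degree p = 3 \<and> (\<forall>x. poly p x = Q1 \<nu>v \<nu>w \<rho> x + t * Q2 \<nu>v \<nu>w \<rho> x)"
    using deg poly_Q_poly by blast
  show "card (Q_zeros \<nu>v \<nu>w \<rho> t) \<in> {1, 2, 3}"
    using card_roots_of_cubic[OF deg] by (simp add: poly_Q_poly Q_zeros_def)
next
  show "\<forall>k\<in>{1, 2, 3}. \<exists>v w r t. v \<noteq> 0 \<and> \<bar>r\<bar> < 1 \<and> t > 0 \<and> card (Q_zeros v w r t) = k"
  proof
    fix k :: nat
    assume "k \<in> {1, 2, 3}"
    then consider "k = 1" | "k = 2" | "k = 3" by auto
    then show "\<exists>v w r t. v \<noteq> 0 \<and> \<bar>r\<bar> < 1 \<and> t > 0 \<and> card (Q_zeros v w r t) = k"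
    proof cases
      case 1
      then show ?thesis using Q_zeros_one
        by (intro exI[of _ 1] exI[of _ 0]) auto
    next
      case 2
      then show ?thesis using Q_zeros_two
        by (intro exI[of _ 1] exI[of _ "1 / sqrt 10"] exI[of _ 0] exI[of _ "4/17"]) auto
    next
      case 3
      then show ?thesis using Q_zeros_three
        by (intro exI[of _ 1] exI[of _ "1/2"] exI[of _ 0] exI[of _ "1/4"]) auto
    qed
  qed
qed

end
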